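(* Let $X$ be a compact metric space and $\varphi:\mathbb{T}^+\times X\to X$ a dynamical system. The set $\mathsf{RNbhd}(\varphi)$ of repelling neighborhoods is a bounded, distributive lattice with respect to the binary operations $\vee=\cup$ and $\wedge=\cap$. The neutral elements are $0=\varnothing$ and $1=X$.
   Context: $\mathbb{T}$ is $\mathbb{Z}$ or $\mathbb{R}$, $\mathbb{T}^+=\{t\in\mathbb{T}:t\ge0\}$. A dynamical system is a continuous map $\varphi:\mathbb{T}^+\times X\to X$ with $\varphi(0,x)=x$ and $\varphi(t,\varphi(s,x))=\varphi(t+s,x)$ for $s,t\in\mathbb{T}^+$ (no invertibility assumed). For $t<0$ and $U\subset X$, $\varphi(t,U)=\{y\in X:\varphi(-t,y)\in U\}$. For $U\subset X$, $\alpha(U)=\bigcap_{t\le0}\mathrm{cl}\big(\bigcup_{s\le t}\varphi(s,U)\big)$. $U\subset X$ is a repelling neighborhood if $\alpha(U)\subset\mathrm{int}(U)$; $\mathsf{RNbhd}(\varphi)$ is the set of all such $U$. *)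

theory Defs
  imports "HOL-Analysis.Analysis"
begin

text \<open>
  The time domain is a subset \<open>T\<close> of the reals, so that the integers and the reals are treated
  uniformly: \<open>T = \<int>\<close> (on which the subspace topology is discrete) or \<open>T = UNIV\<close>.
  The phase space is the carrier of an abstract topology, and a map \<open>\<phi>\<close> is only
  relevant on \<open>nonneg_times T \<times> topspace X\<close>.
\<close>

definition nonneg_times :: "real set \<Rightarrow> real set" where
  "nonneg_times T = {t \<in> T. 0 \<le> t}"

locale dynamical_system =
  fixes T :: "real set" and X :: "'a topology" and \<phi> :: "real \<Rightarrow> 'a \<Rightarrow> 'a"
  assumes time: "T = \<int> \<or> T = UNIV"
    and continuous:
      "continuous_map (prod_topology (top_of_set (nonneg_times T)) X) X (\<lambda>(t, x). \<phi> t x)"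
    and zero: "x \<in> topspace X \<Longrightarrow> \<phi> 0 x = x"
    and add: "\<lbrakk>s \<in> nonneg_times T; t \<in> nonneg_times T; x \<in> topspace X\<rbrakk>
      \<Longrightarrow> \<phi> t (\<phi> s x) = \<phi> (t + s) x"

definition evolve :: "'a topology \<Rightarrow> (real \<Rightarrow> 'a \<Rightarrow> 'a) \<Rightarrow> real \<Rightarrow> 'a set \<Rightarrow> 'a set" where
  "evolve X \<phi> t U = (if t < 0 then {y \<in> topspace X. \<phi> (- t) y \<in> U} else \<phi> t ` U)"

definition alpha_limit ::
    "real set \<Rightarrow> 'a topology \<Rightarrow> (real \<Rightarrow> 'a \<Rightarrow> 'a) \<Rightarrow> 'a set \<Rightarrow> 'a set" where
  "alpha_limit T X \<phi> U =
    (\<Inter>t \<in> {t \<in> T. t \<le> 0}. X closure_of (\<Union>s \<in> {s \<in> T. s \<le> t}. evolve X \<phi> s U))"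

definition RNbhd :: "real set \<Rightarrow> 'a topology \<Rightarrow> (real \<Rightarrow> 'a \<Rightarrow> 'a) \<Rightarrow> 'a set set" where
  "RNbhd T X \<phi> = {U. U \<subseteq> topspace X \<and> alpha_limit T X \<phi> U \<subseteq> X interior_of U}"

text \<open>
  The type-class lattices live on a whole type, and those of \<open>HOL-Algebra\<close> are order-theoretic and
  have no distributive law; hence the algebraic axioms, relativised to a carrier \<open>L\<close>.
\<close>

locale bounded_distributive_lattice =
  fixes L :: "'b set"
    and join :: "'b \<Rightarrow> 'b \<Rightarrow> 'b" (infixl "\<squnion>" 65)
    and meet :: "'b \<Rightarrow> 'b \<Rightarrow> 'b" (infixl "\<sqinter>" 70)
    and zero :: 'b ("\<zero>")
    and one :: 'b ("\<one>")
  assumes join_closed: "\<lbrakk>a \<in> L; b \<in> L\<rbrakk> \<Longrightarrow> a \<squnion> b \<in> L"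
    and meet_closed: "\<lbrakk>a \<in> L; b \<in> L\<rbrakk> \<Longrightarrow> a \<sqinter> b \<in> L"
    and zero_closed: "\<zero> \<in> L"
    and one_closed: "\<one> \<in> L"
    and join_idem: "a \<in> L \<Longrightarrow> a \<squnion> a = a"
    and meet_idem: "a \<in> L \<Longrightarrow> a \<sqinter> a = a"
    and join_commute: "\<lbrakk>a \<in> L; b \<in> L\<rbrakk> \<Longrightarrow> a \<squnion> b = b \<squnion> a"
    and meet_commute: "\<lbrakk>a \<in> L; b \<in> L\<rbrakk> \<Longrightarrow> a \<sqinter> b = b \<sqinter> a"
    and join_assoc: "\<lbrakk>a \<in> L; b \<in> L; c \<in> L\<rbrakk> \<Longrightarrow> (a \<squnion> b) \<squnion> c = a \<squnion> (b \<squnion> c)"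
    and meet_assoc: "\<lbrakk>a \<in> L; b \<in> L; c \<in> L\<rbrakk> \<Longrightarrow> (a \<sqinter> b) \<sqinter> c = a \<sqinter> (b \<sqinter> c)"
    and join_meet_absorb: "\<lbrakk>a \<in> L; b \<in> L\<rbrakk> \<Longrightarrow> a \<squnion> (a \<sqinter> b) = a"
    and meet_join_absorb: "\<lbrakk>a \<in> L; b \<in> L\<rbrakk> \<Longrightarrow> a \<sqinter> (a \<squnion> b) = a"
    and meet_join_distrib:
      "\<lbrakk>a \<in> L; b \<in> L; c \<in> L\<rbrakk> \<Longrightarrow> a \<sqinter> (b \<squnion> c) = (a \<sqinter> b) \<squnion> (a \<sqinter> c)"
    and join_meet_distrib:
      "\<lbrakk>a \<in> L; b \<in> L; c \<in> L\<rbrakk> \<Longrightarrow> a \<squnion> (b \<sqinter> c) = (a \<squnion> b) \<sqinter> (a \<squnion> c)"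
    and join_zero: "a \<in> L \<Longrightarrow> \<zero> \<squnion> a = a"
    and meet_zero: "a \<in> L \<Longrightarrow> \<zero> \<sqinter> a = \<zero>"
    and meet_one: "a \<in> L \<Longrightarrow> \<one> \<sqinter> a = a"
    and join_one: "a \<in> L \<Longrightarrow> \<one> \<squnion> a = \<one>"

end

theory Submission
  imports Defs
begin

text \<open>
  The tails \<open>\<Union>s\<le>t. \<phi>(s, U)\<close> are monotone in \<open>t\<close> and in \<open>U\<close> and commute with binary unions,
  so \<open>\<alpha>\<close> is monotone and \<open>\<alpha>(U \<union> V) = \<alpha>(U) \<union> \<alpha>(V)\<close>: a point outside \<open>\<alpha>(U)\<close> and
  outside \<open>\<alpha>(V)\<close> is excluded at two times, and the earlier of the two excludes it from both.
  Closure of the repelling neighborhoods under \<open>\<union>\<close> and \<open>\<inter>\<close> follows since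
  \<open>int U \<union> int V \<subseteq> int (U \<union> V)\<close> and \<open>int U \<inter> int V = int (U \<inter> V)\<close>.
\<close>

lemma evolve_mono: "U \<subseteq> V \<Longrightarrow> evolve X \<phi> t U \<subseteq> evolve X \<phi> t V"
  by (auto simp: evolve_def)

lemma evolve_Un: "evolve X \<phi> t (U \<union> V) = evolve X \<phi> t U \<union> evolve X \<phi> t V"
  by (auto simp: evolve_def)

lemma evolve_empty [simp]: "evolve X \<phi> t {} = {}"
  by (simp add: evolve_def)

lemma alpha_limit_mono: "U \<subseteq> V \<Longrightarrow> alpha_limit T X \<phi> U \<subseteq> alpha_limit T X \<phi> V"
  unfolding alpha_limit_def by (intro INT_anti_mono closure_of_mono UN_mono evolve_mono) auto

lemma alpha_limit_Un:
  "alpha_limit T X \<phi> (U \<union> V) = alpha_limit T X \<phi> U \<union> alpha_limit T X \<phi> V"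
proof
  define C where "C W t = X closure_of (\<Union>s \<in> {s \<in> T. s \<le> t}. evolve X \<phi> s W)" for W t
  have alpha: "alpha_limit T X \<phi> W = (\<Inter>t \<in> {t \<in> T. t \<le> 0}. C W t)" for W
    by (simp add: alpha_limit_def C_def)
  have C_Un: "C (U \<union> V) t = C U t \<union> C V t" for t
    by (simp add: C_def evolve_Un UN_Un_distrib)
  have C_mono: "C W s \<subseteq> C W t" if "s \<le> t" for W s t
    unfolding C_def using that by (intro closure_of_mono UN_mono) auto
  show "alpha_limit T X \<phi> (U \<union> V) \<subseteq> alpha_limit T X \<phi> U \<union> alpha_limit T X \<phi> V"
  proof (rule ccontr)
    assume "\<not> ?thesis"
    then obtain x s t where x: "x \<in> alpha_limit T X \<phi> (U \<union> V)"
      and s: "s \<in> T" "s \<le> 0" "x \<notin> C U s" and t: "t \<in> T" "t \<le> 0" "x \<notin> C V t"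
      unfolding alpha by blast
    \<comment> \<open>The minimum is one of the two times, so it stays in \<open>T\<close> although
      nothing is assumed about \<open>T\<close> here.\<close>
    have "min s t \<in> T" "min s t \<le> 0"
      using s t by (auto simp: min_def)
    then have "x \<in> C U (min s t) \<union> C V (min s t)"
      using x unfolding alpha C_Un by blast
    then show False
      using s t C_mono[of "min s t" s U] C_mono[of "min s t" t V] by auto
  qed
  show "alpha_limit T X \<phi> U \<union> alpha_limit T X \<phi> V \<subseteq> alpha_limit T X \<phi> (U \<union> V)"
    by (simp add: alpha_limit_mono)
qed

lemma RNbhd_Un:
  assumes "U \<in> RNbhd T X \<phi>" "V \<in> RNbhd T X \<phi>"
  shows "U \<union> V \<in> RNbhd T X \<phi>"
  using assms interior_of_mono[of U "U \<union> V" X] interior_of_mono[of V "U \<union> V" X]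
  by (auto simp: RNbhd_def alpha_limit_Un)

lemma RNbhd_Int:
  assumes "U \<in> RNbhd T X \<phi>" "V \<in> RNbhd T X \<phi>"
  shows "U \<inter> V \<in> RNbhd T X \<phi>"
  using assms alpha_limit_mono[of "U \<inter> V" U T X \<phi>] alpha_limit_mono[of "U \<inter> V" V T X \<phi>]
  by (auto simp: RNbhd_def interior_of_Int)

text \<open>Time 0 keeps the index set of the intersection in \<open>alpha_limit\<close> nonempty;
  over an empty one the intersection would be \<open>UNIV\<close>.\<close>

lemma empty_in_RNbhd:
  assumes "0 \<in> T"
  shows "{} \<in> RNbhd T X \<phi>"
  using assms by (auto simp: RNbhd_def alpha_limit_def)

lemma topspace_in_RNbhd:
  assumes "0 \<in> T"
  shows "topspace X \<in> RNbhd T X \<phi>"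
  using assms closure_of_subset_topspace[of X] by (fastforce simp: RNbhd_def alpha_limit_def)

theorem proposition4p2:
  fixes M :: "'a set" and d :: "'a \<Rightarrow> 'a \<Rightarrow> real"
    and T :: "real set" and \<phi> :: "real \<Rightarrow> 'a \<Rightarrow> 'a"
  assumes "Metric_space M d"
    and "compact_space (Metric_space.mtopology M d)"
    and "dynamical_system T (Metric_space.mtopology M d) \<phi>"
  shows "bounded_distributive_lattice (RNbhd T (Metric_space.mtopology M d) \<phi>) (\<union>) (\<inter>) {} M"
proof -
  let ?X = "Metric_space.mtopology M d"
  have top: "topspace ?X = M"
    using assms(1) by (rule Metric_space.topspace_mtopology)
  have "0 \<in> T"
    using dynamical_system.time[OF assms(3)] by auto
  then have "{} \<in> RNbhd T ?X \<phi>" "M \<in> RNbhd T ?X \<phi>"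
    using empty_in_RNbhd topspace_in_RNbhd[of T ?X \<phi>] by (auto simp: top)
  \<comment> \<open>The laws for the unit, \<open>M \<inter> U = U\<close> and
    \<open>M \<union> U = M\<close>, hold exactly for subsets of \<open>M\<close>.\<close>
  moreover have "U \<subseteq> M" if "U \<in> RNbhd T ?X \<phi>" for U
    using that by (simp add: RNbhd_def top)
  ultimately show ?thesis
    by unfold_locales (auto simp: RNbhd_Un RNbhd_Int)
qed

end
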